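(* Let $a,b,c,d,n$ be positive integers with $a+b=c+d=n$. If the type-A seaweed $\mathfrak{p}_n^{\mathrm A}\frac{a|b}{c|d}$ is Frobenius, then its delta $\Delta$ is well defined and $\Delta\equiv a+d\pmod n$; that is, $t(\beta(i))-i\equiv a+d\pmod n$ for every vertex $i\in\{1,\dots,n\}$, where $t$ and $\beta$ are the top and bottom maps of the seaweed's meander with self-loops added at the endpoints.
   Context: All Lie algebras are over $\mathbb{C}$ with commutator bracket. The index of a Lie algebra $\mathfrak{g}$ is $\min_{f\in\mathfrak{g}^*}\dim\ker B_f$, where $B_f(x,y)=f([x,y])$; $\mathfrak{g}$ is Frobenius if its index is $0$. Type-A seaweed. For compositions $\underline a=(a_1,\dots,a_m)$ and $\underline b=(b_1,\dots,b_r)$ of $n$, let $X_{\underline a}$ be the space of $n\times n$ block-diagonal matrices with consecutive blocks of sizes $a_1,\dots,a_m$, and similarly $X_{\underline b}$; let $\mathscr L,\mathscr U$ be the lower and upper triangular matrices (diagonal included). $\mathfrak{p}_n^{\mathrm A}\frac{a_1|\cdots|a_m}{b_1|\cdots|b_r}$ is the Lie algebra of trace-zero matrices in the span of $(X_{\underline a}\cap\mathscr L)\cup(X_{\underline b}\cap\mathscr U)$. Meander. The meander of this seaweed is the graph on vertices $1,\dots,n$ obtained as follows: partition the vertices into consecutive top blocks of sizes $a_1,\dots,a_m$ and consecutive bottom blocks of sizes $b_1,\dots,b_r$; in each top block join by a top edge the first and last vertices, the second and second-to-last, and so on (distinct vertices only); do the same with bottom edges in each bottom block. For a Frobenius type-A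 seaweed the meander is a single path. Append a self-loop to each of the two endpoints of this path, the self-loop being a top edge if the endpoint has no top edge and a bottom edge if it has no bottom edge. Define $t(i)$ to be the vertex joined to $i$ by a top edge and $\beta(i)$ the vertex joined to $i$ by a bottom edge in this graph with self-loops (so $t(i)=i$ or $\beta(i)=i$ at the corresponding self-loop). The iterates of $t\circ\beta$ give an $n$-cycle on the vertices; when all the differences $t(\beta(i))-i$ modulo $n$ between consecutive elements of the cycle coincide, their common value modulo $n$ is called the delta $\Delta$ of the seaweed. *)

theory Defs
  imports "HOL-Number_Theory.Cong" "Jordan_Normal_Form.VS_Connect"
begin

text \<open>
  A composition is a list of natural numbers. The positions \<open>1, \<dots>, sum_list as\<close> are
  cut into consecutive blocks of sizes \<open>as ! 0, as ! 1, \<dots>\<close>.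
\<close>

definition block :: "nat list \<Rightarrow> nat \<Rightarrow> nat set" where
  "block as k = {sum_list (take k as) <.. sum_list (take (Suc k) as)}"

definition same_block :: "nat list \<Rightarrow> nat \<Rightarrow> nat \<Rightarrow> bool" where
  "same_block as i j \<longleftrightarrow> (\<exists>k < length as. i \<in> block as k \<and> j \<in> block as k)"


section \<open>Matrix Lie algebras and their index\<close>

abbreviation gl :: "nat \<Rightarrow> (complex, complex mat) module" where
  "gl n \<equiv> module_mat TYPE(complex) n n"

definition commutator :: "complex mat \<Rightarrow> complex mat \<Rightarrow> complex mat" where
  "commutator x y = x * y - y * x"

definition dual :: "complex mat set \<Rightarrow> (complex mat \<Rightarrow> complex) set" where
  "dual g = {f. (\<forall>x\<in>g. \<forall>y\<in>g. f (x + y) = f x + f y) \<and> (\<forall>c. \<forall>x\<in>g. f (c \<cdot>\<^sub>m x) = c * f x)}"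

definition ker_B :: "complex mat set \<Rightarrow> (complex mat \<Rightarrow> complex) \<Rightarrow> complex mat set" where
  "ker_B g f = {x \<in> g. \<forall>y\<in>g. f (commutator x y) = 0}"

text \<open>Here \<open>g\<close> is a Lie subalgebra of the \<open>n \<times> n\<close> matrices; the infimum of a nonempty set
  of natural numbers is its minimum.\<close>

definition lie_index :: "nat \<Rightarrow> complex mat set \<Rightarrow> nat" where
  "lie_index n g = (INF f \<in> dual g. vectorspace.dim class_ring ((gl n)\<lparr>carrier := ker_B g f\<rparr>))"

definition frobenius :: "nat \<Rightarrow> complex mat set \<Rightarrow> bool" where
  "frobenius n g \<longleftrightarrow> lie_index n g = 0"


section \<open>Type-A seaweeds\<close>

text \<open>Matrix entries are indexed from \<open>0\<close>, block positions and meander vertices from \<open>1\<close>.\<close>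

definition block_diagonal :: "nat \<Rightarrow> nat list \<Rightarrow> complex mat set" where
  "block_diagonal n as =
     {A \<in> carrier_mat n n. \<forall>i<n. \<forall>j<n. \<not> same_block as (Suc i) (Suc j) \<longrightarrow> A $$ (i, j) = 0}"

definition upper_mats :: "nat \<Rightarrow> complex mat set" where
  "upper_mats n = {A \<in> carrier_mat n n. upper_triangular A}"

definition lower_mats :: "nat \<Rightarrow> complex mat set" where
  "lower_mats n = {A \<in> carrier_mat n n. upper_triangular (transpose_mat A)}"

definition seaweed_A :: "nat \<Rightarrow> nat list \<Rightarrow> nat list \<Rightarrow> complex mat set" where
  "seaweed_A n as bs =
     {A \<in> LinearCombinations.module.span class_ring (gl n)
            (block_diagonal n as \<inter> lower_mats n \<union> block_diagonal n bs \<inter> upper_mats n).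
        (\<Sum>i<n. A $$ (i, i)) = 0}"


section \<open>Meanders\<close>

definition arc :: "nat list \<Rightarrow> nat \<Rightarrow> nat \<Rightarrow> bool" where
  "arc as i j \<longleftrightarrow> i \<noteq> j \<and> (\<exists>k < length as. i \<in> block as k \<and> j \<in> block as k \<and>
     i + j = sum_list (take k as) + 1 + sum_list (take (Suc k) as))"

text \<open>
  The meander is a multigraph whose edges are the top edges \<open>arc as\<close> and the bottom edges
  \<open>arc bs\<close>. Every vertex lies on at most one edge of each kind, so the vertices of degree one,
  which are the endpoints of the meander when it is a path with at least two vertices, are those
  lying on an edge of exactly one kind.
\<close>

definition meander_endpoint :: "nat list \<Rightarrow> nat list \<Rightarrow> nat \<Rightarrow> bool" where
  "meander_endpoint as bs i \<longleftrightarrow> i \<in> {1..sum_list as} \<and> ((\<exists>j. arc as i j) \<noteq> (\<exists>j. arc bs i j))"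

definition top_edge :: "nat list \<Rightarrow> nat list \<Rightarrow> nat \<Rightarrow> nat \<Rightarrow> bool" where
  "top_edge as bs i j \<longleftrightarrow> arc as i j \<or>
     (i = j \<and> meander_endpoint as bs i \<and> \<not> (\<exists>l. arc as i l))"

definition bottom_edge :: "nat list \<Rightarrow> nat list \<Rightarrow> nat \<Rightarrow> nat \<Rightarrow> bool" where
  "bottom_edge as bs i j \<longleftrightarrow> arc bs i j \<or>
     (i = j \<and> meander_endpoint as bs i \<and> \<not> (\<exists>l. arc bs i l))"

definition top_map :: "nat list \<Rightarrow> nat list \<Rightarrow> nat \<Rightarrow> nat" where
  "top_map as bs i = (THE j. top_edge as bs i j)"

definition bottom_map :: "nat list \<Rightarrow> nat list \<Rightarrow> nat \<Rightarrow> nat" where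
  "bottom_map as bs i = (THE j. bottom_edge as bs i j)"

definition step_difference :: "nat list \<Rightarrow> nat list \<Rightarrow> nat \<Rightarrow> int" where
  "step_difference as bs i = int (top_map as bs (bottom_map as bs i)) - int i"

text \<open>
  For a Frobenius seaweed the iterates of the top map after the bottom map run through all
  vertices in one cycle, so the differences between consecutive elements of that cycle are the
  values of \<open>step_difference\<close> at all vertices. The first two conjuncts say that the top and
  bottom maps are genuine maps on the vertices.
\<close>

definition delta_well_defined :: "nat list \<Rightarrow> nat list \<Rightarrow> bool" where
  "delta_well_defined as bs \<longleftrightarrow>
     (let n = sum_list as in
       (\<forall>i\<in>{1..n}. (\<exists>!j. top_edge as bs i j) \<and> top_map as bs i \<in> {1..n}) \<and>
       (\<forall>i\<in>{1..n}. (\<exists>!j. bottom_edge as bs i j) \<and> bottom_map as bs i \<in> {1..n}) \<and>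
       (\<forall>i\<in>{1..n}. \<forall>j\<in>{1..n}. [step_difference as bs i = step_difference as bs j] (mod int n)))"

text \<open>The common value, represented by its residue in \<open>{0..<n}\<close>.\<close>

definition delta :: "nat list \<Rightarrow> nat list \<Rightarrow> int" where
  "delta as bs =
     (THE D. D \<in> {0..<int (sum_list as)} \<and>
        (\<forall>i\<in>{1..sum_list as}. [step_difference as bs i = D] (mod int (sum_list as))))"

end

theory Submission
  imports Defs
begin

text \<open>
  If \<open>a = c\<close>, the seaweed is \<open>(gl_a \<oplus> gl_b) \<inter> sl_n\<close>, whose centre contains the matrix
  \<open>diag (b, \<dots>, b, -a, \<dots>, -a)\<close>; a nonzero central element lies in the kernel of every form
  \<open>B_f\<close>, so the seaweed is not Frobenius. Hence \<open>a \<noteq> c\<close>, no vertex is the midpoint of both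
  its blocks, and the self-loops make \<open>t\<close> and \<open>\<beta>\<close> the reflections of the blocks. Modulo \<open>n\<close>
  these are \<open>i \<mapsto> a + 1 - i\<close> and \<open>i \<mapsto> c + 1 - i\<close> in both blocks, so \<open>t \<circ> \<beta>\<close> is the translation
  by \<open>a - c\<close>, which is congruent to \<open>a + d\<close>.
\<close>

section \<open>Finite-dimensionality of matrix spaces and their subspaces\<close>

text \<open>Independent subsets of \<open>W\<close> stay independent in \<open>V\<close>, so their
  size is bounded by \<open>dim\<close>; a maximal one exists and is a basis of
  \<open>W\<close>.\<close>

lemma (in vectorspace) subspace_fin_dim:
  assumes "fin_dim" and W: "subspace K W V"
  shows "vectorspace.fin_dim K (vs W)"
proof -
  interpret W: vectorspace K "vs W" using W by (rule subspace_is_vs)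
  have sub: "submodule K W V" using W by (simp add: subspace_def)
  then have WV: "W \<subseteq> carrier V" by (simp add: submodule_def)
  have "finite S \<and> card S \<le> dim" if "S \<subseteq> carrier (vs W) \<and> W.lin_indpt S" for S
    using that span_li_not_depend(2)[OF _ sub, of S] WV li_le_dim[OF assms(1), of S] by auto
  moreover have "W.lin_indpt {}"
    by (auto simp: W.lin_dep_def)
  ultimately obtain A where "finite A" "maximal A (\<lambda>S. S \<subseteq> carrier (vs W) \<and> W.lin_indpt S)"
    using maximal_exists[of "\<lambda>S. S \<subseteq> carrier (vs W) \<and> W.lin_indpt S" dim "{}"] by auto
  then show ?thesis
    using W.max_li_is_basis[of A] unfolding W.fin_dim_def W.basis_def by blast
qed

lemma (in vectorspace) dim_0_imp_trivial:
  assumes "fin_dim" and "dim = 0"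
  shows "carrier V = {\<zero>\<^bsub>V\<^esub>}"
proof -
  obtain \<beta> where \<beta>: "finite \<beta>" "basis \<beta>" using finite_basis_exists[OF assms(1)] by blast
  then have "\<beta> = {}" using dim_basis[of \<beta>] assms(2) by simp
  then show ?thesis using \<beta>(2) span_empty by (simp add: basis_def)
qed

lemma fin_dim_gl: "vectorspace.fin_dim class_ring (gl n)"
proof -
  interpret matrix_vs n n "TYPE(complex)" .
  define E :: "nat \<times> nat \<Rightarrow> complex mat" where
    "E p = mat n n (\<lambda>q. if q = p then 1 else 0)" for p
  have carr: "E ` P \<subseteq> carrier_mat n n" for P by (auto simp: E_def)
  \<comment> \<open>The matrix units span: induction on a finite set \<open>P\<close> of positions
    outside which \<open>A\<close> vanishes, splitting off one entry at a time.\<close>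
  have gen: "A \<in> span (E ` P)"
    if "finite P" "A \<in> carrier_mat n n" "\<forall>i<n. \<forall>j<n. (i, j) \<notin> P \<longrightarrow> A $$ (i, j) = 0" for P A
    using that
  proof (induction P arbitrary: A rule: finite_induct)
    case empty
    then have "A = 0\<^sub>m n n" by auto
    then show ?case using span_zero[of "{}"] by simp
  next
    case (insert p P)
    let ?B = "mat n n (\<lambda>q. if q = p then 0 else A $$ q)"
    have "?B \<in> span (E ` P)" by (rule insert.IH) (use insert.prems in auto)
    then have B: "?B \<in> span (E ` insert p P)"
      using span_is_monotone[of "E ` P" "E ` insert p P"] by auto
    have sub: "submodule class_ring (span (E ` insert p P)) V"
      by (rule span_is_submodule) (rule carr)
    have "E p \<in> span (E ` insert p P)"
      using in_own_span[OF carr] by blast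
    then have "(A $$ p) \<cdot>\<^sub>m E p + ?B \<in> span (E ` insert p P)"
      using B submodule.smult_closed[OF sub] submodule.m_closed[OF sub]
      by (simp add: matrix_vs_simps)
    moreover have "(A $$ p) \<cdot>\<^sub>m E p + ?B = A"
      using insert.prems by (intro eq_matI) (auto simp: E_def)
    ultimately show ?case by simp
  qed
  have "carrier_mat n n \<subseteq> span (E ` ({..<n} \<times> {..<n}))"
    by (auto intro: gen)
  moreover have "span (E ` ({..<n} \<times> {..<n})) \<subseteq> carrier_mat n n"
    by (rule span_is_subset2) (rule carr)
  ultimately have "span (E ` ({..<n} \<times> {..<n})) = carrier_mat n n" by (rule subset_antisym[rotated])
  moreover have "finite (E ` ({..<n} \<times> {..<n}))" by simp
  ultimately show ?thesis
    unfolding fin_dim_def using carr by (intro exI[of _ "E ` ({..<n} \<times> {..<n})"]) simp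
qed

section \<open>Central elements and the index\<close>

lemma commutator_add_left:
  assumes "x \<in> carrier_mat n n" "x' \<in> carrier_mat n n" "y \<in> carrier_mat n n"
  shows "commutator (x + x') y = commutator x y + commutator x' y"
  using assms unfolding commutator_def
  by (intro eq_matI) (auto simp: add_mult_distrib_mat[of _ n n] mult_add_distrib_mat[of _ n n])

lemma commutator_smult_left:
  assumes "x \<in> carrier_mat n n" "y \<in> carrier_mat n n"
  shows "commutator (c \<cdot>\<^sub>m x) y = c \<cdot>\<^sub>m commutator x y"
  using assms unfolding commutator_def
  by (intro eq_matI) (auto simp: mult_smult_distrib[of _ n n] mult_smult_assoc_mat[of _ n n] algebra_simps)

lemma dual_zero:
  assumes "f \<in> dual g" "0\<^sub>m n n \<in> g"
  shows "f (0\<^sub>m n n) = 0"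
proof -
  have "f (0 \<cdot>\<^sub>m 0\<^sub>m n n) = 0 * f (0\<^sub>m n n)" using assms unfolding dual_def by blast
  moreover have "0 \<cdot>\<^sub>m 0\<^sub>m n n = (0\<^sub>m n n :: complex mat)" by auto
  ultimately show ?thesis by simp
qed

text \<open>A central \<open>z\<close> satisfies f([z, y]) = f(0) = 0 for every form f, so no kernel
  is trivial. Most of the work shows that \<open>ker_B g f\<close> is a subspace, which is what lets
  dimension 0 force it to be zero.\<close>

lemma central_element_imp_not_frobenius:
  assumes g: "submodule class_ring g (gl n)"
    and comm: "\<And>x y. x \<in> g \<Longrightarrow> y \<in> g \<Longrightarrow> commutator x y \<in> g"
    and z: "z \<in> g" "z \<noteq> 0\<^sub>m n n" "\<And>y. y \<in> g \<Longrightarrow> commutator z y = 0\<^sub>m n n"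
  shows "\<not> frobenius n g"
proof
  assume "frobenius n g"
  have gc: "g \<subseteq> carrier_mat n n" and g0: "0\<^sub>m n n \<in> g"
    and gadd: "\<And>x y. x \<in> g \<Longrightarrow> y \<in> g \<Longrightarrow> x + y \<in> g"
    and gsm: "\<And>c x. x \<in> g \<Longrightarrow> c \<cdot>\<^sub>m x \<in> g"
    using g unfolding submodule_def by (auto simp: module_mat_simps)
  have "(\<lambda>_. 0) \<in> dual g" by (simp add: dual_def)
  \<comment> \<open>An infimum over a nonempty set of naturals is attained, so index 0 yields an
    actual form with zero-dimensional kernel.\<close>
  then obtain f where f: "f \<in> dual g"
    and dim0: "vectorspace.dim class_ring ((gl n)\<lparr>carrier := ker_B g f\<rparr>) = 0"
    using \<open>frobenius n g\<close> Inf_nat_def1[of "(\<lambda>f. vectorspace.dim class_ring ((gl n)\<lparr>carrier := ker_B g f\<rparr>)) ` dual g"]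
    unfolding frobenius_def lie_index_def by (metis (no_types, lifting) empty_iff image_iff image_is_empty)
  interpret matrix_vs n n "TYPE(complex)" .
  have f0: "f (0\<^sub>m n n) = 0" using dual_zero[OF f g0] .
  have fadd: "f (x + y) = f x + f y" if "x \<in> g" "y \<in> g" for x y
    using f that by (simp add: dual_def)
  have fsm: "f (c \<cdot>\<^sub>m x) = c * f x" if "x \<in> g" for c x
    using f that by (simp add: dual_def)
  have "commutator (0\<^sub>m n n) y = 0\<^sub>m n n" if "y \<in> g" for y
    using that gc by (auto simp: commutator_def)
  then have zero: "0\<^sub>m n n \<in> ker_B g f"
    using f0 g0 by (auto simp: ker_B_def)
  \<comment> \<open>Forms in \<open>dual g\<close> are linear only on \<open>g\<close>;
    \<open>comm\<close> puts the commutators there.\<close>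
  have addc: "x + x' \<in> ker_B g f" if "x \<in> ker_B g f" "x' \<in> ker_B g f" for x x'
  proof -
    have "f (commutator (x + x') y) = 0" if "y \<in> g" for y
      using \<open>x \<in> ker_B g f\<close> \<open>x' \<in> ker_B g f\<close> that gc
      by (auto simp: ker_B_def subset_iff commutator_add_left[of _ n] fadd comm)
    then show ?thesis using that gadd by (auto simp: ker_B_def)
  qed
  have smc: "c \<cdot>\<^sub>m x \<in> ker_B g f" if "x \<in> ker_B g f" for c x
  proof -
    have "f (commutator (c \<cdot>\<^sub>m x) y) = 0" if "y \<in> g" for y
      using \<open>x \<in> ker_B g f\<close> that gc
      by (auto simp: ker_B_def subset_iff commutator_smult_left[of _ n] fsm comm)
    then show ?thesis using that gsm by (auto simp: ker_B_def)
  qed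
  have "submodule class_ring (ker_B g f) V"
    using zero addc smc gc module_axioms by (auto simp: submodule_def matrix_vs_simps ker_B_def)
  then have sub: "subspace class_ring (ker_B g f) V"
    using vectorspace_axioms by (simp add: subspace_def)
  then have "carrier (vs (ker_B g f)) = {zero (vs (ker_B g f))}"
    using vectorspace.dim_0_imp_trivial[OF subspace_is_vs subspace_fin_dim[OF fin_dim_gl]] dim0
    by auto
  then have "ker_B g f = {0\<^sub>m n n}" by (simp add: module_mat_simps)
  moreover have "z \<in> ker_B g f" using z(1,3) f0 by (simp add: ker_B_def)
  ultimately show False using z(2) by auto
qed

section \<open>Seaweeds with equal top and bottom compositions\<close>

text \<open>Partial sums are monotone, so half-open intervals with different indices are
  disjoint.\<close>

lemma block_unique:
  assumes "i \<in> block as k" "i \<in> block as l"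
  shows "k = l"
proof -
  have mono: "sum_list (take p as) \<le> sum_list (take q as)" if pq: "p \<le> q" for p q
  proof -
    obtain r where "q = p + r" using le_Suc_ex[OF pq] by auto
    then have "sum_list (take q as) = sum_list (take p as) + sum_list (take r (drop p as))"
      by (simp only: take_add sum_list_append)
    then show ?thesis by simp
  qed
  then have "\<not> p < q" if "i \<in> block as p" "i \<in> block as q" for p q
    using that mono[of "Suc p" q]
    unfolding block_def greaterThanAtMost_iff Suc_le_eq by linarith
  then show ?thesis using assms by (meson linorder_neqE_nat)
qed

lemma same_block_trans:
  "same_block as i j \<Longrightarrow> same_block as j k \<Longrightarrow> same_block as i k"
  unfolding same_block_def by (blast dest: block_unique)

lemma block_diagonal_mult:
  assumes "A \<in> block_diagonal n as" "B \<in> block_diagonal n as"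
  shows "A * B \<in> block_diagonal n as"
proof -
  \<comment> \<open>A nonzero term would put i and k, and also k and j, in a common block, hence i
    and j as well.\<close>
  have "(\<Sum>k<n. A $$ (i, k) * B $$ (k, j)) = 0"
    if "i < n" "j < n" "\<not> same_block as (Suc i) (Suc j)" for i j
    using assms that same_block_trans[of as "Suc i" _ "Suc j"]
    by (intro sum.neutral) (fastforce simp: block_diagonal_def)
  then show ?thesis
    using assms by (auto simp: block_diagonal_def scalar_prod_def atLeast0LessThan)
qed

lemma submodule_block_diagonal: "submodule class_ring (block_diagonal n as) (gl n)"
proof -
  interpret matrix_vs n n "TYPE(complex)" .
  show ?thesis
    using module_axioms by (auto simp: submodule_def matrix_vs_simps block_diagonal_def)
qed

lemma seaweed_A_diagonal:
  "seaweed_A n as as = {A \<in> block_diagonal n as. (\<Sum>i<n. A $$ (i, i)) = 0}"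
proof -
  interpret matrix_vs n n "TYPE(complex)" .
  let ?S = "block_diagonal n as \<inter> lower_mats n \<union> block_diagonal n as \<inter> upper_mats n"
  have S: "?S \<subseteq> carrier_mat n n" by (auto simp: block_diagonal_def)
  have "span ?S \<subseteq> block_diagonal n as"
    by (rule span_is_subset[OF _ submodule_block_diagonal]) auto
  moreover have "A \<in> span ?S" if A: "A \<in> block_diagonal n as" for A
  proof -
    \<comment> \<open>The diagonal goes entirely to the lower part, so that \<open>?L + ?U\<close>
      does not count it twice.\<close>
    let ?L = "mat n n (\<lambda>(i, j). if j \<le> i then A $$ (i, j) else 0)"
    let ?U = "mat n n (\<lambda>(i, j). if j \<le> i then 0 else A $$ (i, j))"
    have "?L \<in> ?S" "?U \<in> ?S"
      using A by (auto simp: block_diagonal_def lower_mats_def upper_mats_def)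
    then have "?L \<in> span ?S" "?U \<in> span ?S" using in_own_span[OF S] by blast+
    then have "?L + ?U \<in> span ?S"
      using submodule.m_closed[OF span_is_submodule[OF S]] by (simp add: matrix_vs_simps)
    moreover have "?L + ?U = A"
      using A by (intro eq_matI) (auto simp: block_diagonal_def)
    ultimately show ?thesis by simp
  qed
  ultimately have "span ?S = block_diagonal n as" by blast
  then show ?thesis by (simp add: seaweed_A_def)
qed

lemma submodule_seaweed_A_diagonal: "submodule class_ring (seaweed_A n as as) (gl n)"
  using submodule_block_diagonal[of n as] unfolding submodule_def seaweed_A_diagonal
  by (auto simp: matrix_vs_simps block_diagonal_def sum.distrib simp flip: sum_distrib_left)

lemma commutator_trace_zero:
  assumes "A \<in> carrier_mat n n" "B \<in> carrier_mat n n"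
  shows "(\<Sum>i<n. commutator A B $$ (i, i)) = 0"
proof -
  have "(\<Sum>i<n. \<Sum>k<n. A $$ (i, k) * B $$ (k, i)) = (\<Sum>i<n. \<Sum>k<n. B $$ (i, k) * A $$ (k, i))"
    by (subst sum.swap) (simp add: mult.commute)
  then show ?thesis
    using assms by (simp add: commutator_def scalar_prod_def atLeast0LessThan sum_subtractf)
qed

lemma seaweed_A_diagonal_commutator:
  assumes "A \<in> seaweed_A n as as" "B \<in> seaweed_A n as as"
  shows "commutator A B \<in> seaweed_A n as as"
proof -
  have A: "A \<in> block_diagonal n as" "A \<in> carrier_mat n n"
    and B: "B \<in> block_diagonal n as" "B \<in> carrier_mat n n"
    using assms by (auto simp: seaweed_A_diagonal block_diagonal_def)
  have "commutator A B \<in> block_diagonal n as"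
    using block_diagonal_mult[OF A(1) B(1)] block_diagonal_mult[OF B(1) A(1)]
      A(2) B(2) by (auto simp: commutator_def block_diagonal_def)
  then show ?thesis using commutator_trace_zero A(2) B(2) by (simp add: seaweed_A_diagonal)
qed

lemma ex_block_pair:
  "(\<exists>k < length [a, b]. P k) \<longleftrightarrow> P 0 \<or> P (Suc 0)"
  by (auto simp: less_Suc_eq)

lemma same_block_pair:
  "same_block [a, b] i j \<longleftrightarrow>
     i \<in> {1..a} \<and> j \<in> {1..a} \<or> i \<in> {a<..a + b} \<and> j \<in> {a<..a + b}"
  unfolding same_block_def ex_block_pair by (auto simp: block_def)

lemma seaweed_A_diagonal_not_frobenius:
  assumes "a > 0" "b > 0"
  shows "\<not> frobenius (a + b) (seaweed_A (a + b) [a, b] [a, b])"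
proof -
  let ?n = "a + b"
  \<comment> \<open>The weights b on a positions and -a on b positions make the trace ab - ba = 0.
    Matrix indices start at 0, so \<open>i < a\<close> is the first block.\<close>
  define w :: "nat \<Rightarrow> complex" where "w i = (if i < a then of_nat b else - of_nat a)" for i
  define z where "z = mat ?n ?n (\<lambda>(i, j). if i = j then w i else 0)"
  have "(\<Sum>i<a + b. w i) = (\<Sum>i<a. w i) + (\<Sum>i=a..<a + b. w i)"
    by (simp add: lessThan_atLeast0 sum.atLeastLessThan_concat)
  also have "\<dots> = 0" by (simp add: w_def)
  finally have "z \<in> seaweed_A ?n [a, b] [a, b]"
    by (auto simp: z_def seaweed_A_diagonal block_diagonal_def same_block_pair)
  moreover have "z \<noteq> 0\<^sub>m ?n ?n"
  proof
    assume "z = 0\<^sub>m ?n ?n"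
    then have "z $$ (0, 0) = 0" using assms by simp
    then show False using assms by (simp add: z_def w_def)
  qed
  moreover have "commutator z y = 0\<^sub>m ?n ?n" if "y \<in> seaweed_A ?n [a, b] [a, b]" for y
  proof -
    have y: "y \<in> carrier_mat ?n ?n"
      \<comment> \<open>Different weights mean different blocks. Hence the entries
        \<open>w i * y $$ (i, j)\<close> of zy and \<open>y $$ (i, j) * w j\<close> of yz agree:
        either the weights are equal or the entry of y is zero.\<close>
      and y0: "\<And>i j. i < ?n \<Longrightarrow> j < ?n \<Longrightarrow> w i \<noteq> w j \<Longrightarrow> y $$ (i, j) = 0"
      using that
      by (auto simp: seaweed_A_diagonal block_diagonal_def same_block_pair w_def split: if_splits)
    have "(\<Sum>k<?n. z $$ (i, k) * y $$ (k, j)) = w i * y $$ (i, j)"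
      "(\<Sum>k<?n. y $$ (i, k) * z $$ (k, j)) = y $$ (i, j) * w j" if "i < ?n" "j < ?n" for i j
    proof -
      have "(\<Sum>k<?n. z $$ (i, k) * y $$ (k, j)) = (\<Sum>k<?n. if k = i then w i * y $$ (i, j) else 0)"
        "(\<Sum>k<?n. y $$ (i, k) * z $$ (k, j)) = (\<Sum>k<?n. if k = j then y $$ (i, j) * w j else 0)"
        using that by (intro sum.cong; simp add: z_def)+
      then show "(\<Sum>k<?n. z $$ (i, k) * y $$ (k, j)) = w i * y $$ (i, j)"
        "(\<Sum>k<?n. y $$ (i, k) * z $$ (k, j)) = y $$ (i, j) * w j"
        using that by (simp_all add: sum.delta)
    qed
    moreover have "w i * y $$ (i, j) = y $$ (i, j) * w j" if "i < ?n" "j < ?n" for i j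
      using y0[OF that] by (cases "w i = w j") auto
    moreover have "z \<in> carrier_mat ?n ?n" by (simp add: z_def)
    ultimately show ?thesis using y
      by (intro eq_matI) (auto simp: commutator_def scalar_prod_def atLeast0LessThan)
  qed
  ultimately show ?thesis
    by (intro central_element_imp_not_frobenius[OF submodule_seaweed_A_diagonal])
      (auto intro: seaweed_A_diagonal_commutator)
qed

section \<open>Block reflections and the edges of a two-block meander\<close>

text \<open>The order reversal of each of the blocks {1..a} and {a+1..a+b}; the constants
  \<open>a + 1\<close> and \<open>2 * a + b + 1\<close> are the sums of their first and last
  vertices.\<close>

definition block_reflection :: "nat \<Rightarrow> nat \<Rightarrow> nat \<Rightarrow> nat" where
  "block_reflection a b i = (if i \<le> a then a + 1 - i else 2 * a + b + 1 - i)"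

lemma block_reflection_in:
  "i \<in> {1..a + b} \<Longrightarrow> block_reflection a b i \<in> {1..a + b}"
  by (auto simp: block_reflection_def)

text \<open>The two branches of the reflection differ by exactly a + b, so one formula serves both
  blocks modulo n.\<close>

lemma block_reflection_cong:
  assumes "i \<in> {1..a + b}"
  shows "[int (block_reflection a b i) = int a + 1 - int i] (mod int (a + b))"
proof -
  have "int (block_reflection a b i) - (int a + 1 - int i) \<in> {0, int (a + b)}"
    using assms by (auto simp: block_reflection_def of_nat_diff)
  then show ?thesis by (metis cong_iff_dvd_diff dvd_0_right dvd_refl empty_iff insert_iff)
qed

lemma arc_pair:
  assumes "i \<in> {1..a + b}"
  shows "arc [a, b] i j \<longleftrightarrow> j = block_reflection a b i \<and> j \<noteq> i"
  using assms unfolding arc_def ex_block_pair by (auto simp: block_def block_reflection_def)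

text \<open>Twice a fixed point is a + 1 or 2a + b + 1 for the first reflection, and c + 1 or 2c + d
  + 1 for the second. Equating first with first or second with second gives a = c; a mixed case
  would give a = c + n or c = a + n, which is too large.\<close>

lemma common_center_imp_eq:
  assumes "a > 0" "b > 0" "c > 0" "d > 0" "a + b = c + d" "i \<in> {1..a + b}"
    and "block_reflection a b i = i" "block_reflection c d i = i"
  shows "a = c"
  using assms by (auto simp: block_reflection_def split: if_splits)

text \<open>A fixed point of one reflection has no arc of that kind but, as the centers differ, has
  one of the other kind. It is therefore an endpoint, and its self-loop supplies exactly the missing
  value of the reflection.\<close>

lemma meander_edges_pair:
  assumes "a > 0" "b > 0" "c > 0" "d > 0" "a + b = c + d" "a \<noteq> c" "i \<in> {1..a + b}"
  shows "top_edge [a, b] [c, d] i j \<longleftrightarrow> j = block_reflection a b i"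
    and "bottom_edge [a, b] [c, d] i j \<longleftrightarrow> j = block_reflection c d i"
proof -
  have "i \<in> {1..c + d}" using assms by simp
  moreover have "block_reflection a b i \<noteq> i \<or> block_reflection c d i \<noteq> i"
    using common_center_imp_eq[of a b c d i] assms by blast
  ultimately show "top_edge [a, b] [c, d] i j \<longleftrightarrow> j = block_reflection a b i"
    and "bottom_edge [a, b] [c, d] i j \<longleftrightarrow> j = block_reflection c d i"
    using assms(7)
    unfolding top_edge_def bottom_edge_def meander_endpoint_def by (auto simp: arc_pair)
qed

theorem theorem6p17:
  fixes a b c d n :: nat
  assumes "a > 0" and "b > 0" and "c > 0" and "d > 0" and "n > 0"
    and "a + b = n" and "c + d = n"
    and "frobenius n (seaweed_A n [a, b] [c, d])"
  shows "delta_well_defined [a, b] [c, d]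
    \<and> [delta [a, b] [c, d] = int (a + d)] (mod int n)
    \<and> (\<forall>i\<in>{1..n}. [int (top_map [a, b] [c, d] (bottom_map [a, b] [c, d] i)) - int i
                       = int (a + d)] (mod int n))"
proof -
  have "a \<noteq> c"
  proof
    assume "a = c"
    then have "d = b" using assms by simp
    then show False
      using seaweed_A_diagonal_not_frobenius[of a b] assms \<open>a = c\<close> by metis
  qed
  then have edges: "top_edge [a, b] [c, d] i j \<longleftrightarrow> j = block_reflection a b i"
    "bottom_edge [a, b] [c, d] i j \<longleftrightarrow> j = block_reflection c d i" if "i \<in> {1..n}" for i j
    using meander_edges_pair[of a b c d i j] assms that by auto
  have maps: "top_map [a, b] [c, d] i = block_reflection a b i"
    "bottom_map [a, b] [c, d] i = block_reflection c d i" if "i \<in> {1..n}" for i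
    using that by (simp_all add: top_map_def bottom_map_def edges)
  have range: "block_reflection a b i \<in> {1..n}" "block_reflection c d i \<in> {1..n}"
    if "i \<in> {1..n}" for i
    using block_reflection_in[of i a b] block_reflection_in[of i c d] that assms by auto
  have step: "[step_difference [a, b] [c, d] i = int (a + d)] (mod int n)" if i: "i \<in> {1..n}" for i
  proof -
    let ?t = "int (block_reflection a b (block_reflection c d i))"
    let ?b = "int (block_reflection c d i)"
    have "[?t = int a + 1 - ?b] (mod int n)"
      using block_reflection_cong[of "block_reflection c d i" a b] range[OF i] assms by simp
    also have "[int a + 1 - ?b = int a + 1 - (int c + 1 - int i)] (mod int n)"
      using block_reflection_cong[of i c d] i assms by (intro cong_diff cong_refl) simp
    finally have "[?t - int i = (int a + 1 - (int c + 1 - int i)) - int i] (mod int n)"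
      by (rule cong_diff) (rule cong_refl)
    \<comment> \<open>The difference collapses to a - c, and c = n - d.\<close>
    also have "(int a + 1 - (int c + 1 - int i)) - int i = int (a + d) - int n"
      using assms by auto
    also have "[int (a + d) - int n = int (a + d)] (mod int n)"
      by (simp add: cong_iff_dvd_diff)
    finally show ?thesis using range[OF i] i by (simp add: step_difference_def maps)
  qed
  have "delta_well_defined [a, b] [c, d]"
  proof -
    have n: "sum_list [a, b] = n" using assms by simp
    have ex1: "\<exists>!j. top_edge [a, b] [c, d] i j" "\<exists>!j. bottom_edge [a, b] [c, d] i j"
      if "i \<in> {1..n}" for i
      using edges[OF that] by simp_all
    have step_eq: "[step_difference [a, b] [c, d] i = step_difference [a, b] [c, d] j] (mod int n)"
      if "i \<in> {1..n}" "j \<in> {1..n}" for i j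
      by (rule cong_trans[OF step[OF that(1)] cong_sym[OF step[OF that(2)]]])
    show ?thesis
      unfolding delta_well_defined_def Let_def n
      by (intro conjI ballI ex1 step_eq) (simp_all only: maps range)
  qed
  \<comment> \<open>\<open>delta\<close> is the representative in \<open>{0..<n}\<close>, hence the
    residue of a + d. For uniqueness, the vertex 1 already determines \<open>D\<close>, and it
    exists because n > 0.\<close>
  moreover have "delta [a, b] [c, d] = int (a + d) mod int n"
    unfolding delta_def
  proof (rule the_equality, goal_cases)
    case 1
    then show ?case using step assms by (auto simp: cong_def)
  next
    case (2 D)
    then have "[step_difference [a, b] [c, d] 1 = D] (mod int n)" "D mod int n = D"
      using assms by auto
    then show ?case using step[of 1] assms(5) by (simp add: cong_def)
  qed
  ultimately show ?thesis using step by (simp add: step_difference_def cong_def)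
qed

end
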